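(* Let $a$ and $b$ be digits, and let $c,d$ be the integers with $0\le c,d\le 9$ and $a\times b=10c+d$. Then: (1) if $d\le 3$, then $(a,a)\bowtie b=c+d$; (2) if $d>3$, then $(a,a)\bowtie b=c+d-9$.
   Context: A digit is an element of $\{0,1,\dots,9\}$. For nonnegative integers $x,y$, let $u\in\{0,\dots,9\}$ be the ones digit of the usual product $x\times y$. The plum-blossom product $x\clubsuit y$ is defined by $x\clubsuit y=u$ if $u\le 3$, and $x\clubsuit y=u-10$ if $u>3$. The carry $J(x\clubsuit y)$ is the integer determined by $x\times y=10\,J(x\clubsuit y)+x\clubsuit y$; it depends on the pair $(x,y)$, not only on the value $x\clubsuit y$. For digits $a,b,c$, the plum-blossom wedge product of $(a,b)$ and $c$ is $(a,b)\bowtie c=a\clubsuit c+J(b\clubsuit c)$. *)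

theory Defs
  imports Main
begin

definition digits :: "nat set" where
  "digits = {0..9}"

definition plum :: "nat \<Rightarrow> nat \<Rightarrow> int" (infixl "\<clubsuit>" 70) where
  "x \<clubsuit> y = (let u = (x * y) mod 10 in if u \<le> 3 then int u else int u - 10)"

text \<open>The carry is a function of the pair of factors, not of the value of their product.\<close>

definition plum_carry :: "nat \<Rightarrow> nat \<Rightarrow> int" where
  "plum_carry x y = (THE j. int (x * y) = 10 * j + x \<clubsuit> y)"

lemma plum_carry_ex1: "\<exists>!j. int (x * y) = 10 * j + x \<clubsuit> y"
proof -
  define n where "n = x * y"
  have n: "int n = 10 * int (n div 10) + int (n mod 10)"
    by presburger
  show ?thesis
  proof (cases "n mod 10 \<le> 3")
    case True
    with n show ?thesis
      unfolding plum_def n_def[symmetric] Let_def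
      by (intro ex1I[of _ "int (n div 10)"]) auto
  next
    case False
    with n show ?thesis
      unfolding plum_def n_def[symmetric] Let_def
      by (intro ex1I[of _ "int (n div 10) + 1"]) auto
  qed
qed

lemma plum_carry_eq: "int (x * y) = 10 * plum_carry x y + x \<clubsuit> y"
  unfolding plum_carry_def by (rule theI') (rule plum_carry_ex1)

text \<open>The wedge is total on natural numbers; only its values on digits are meaningful.\<close>

definition plum_wedge :: "nat \<times> nat \<Rightarrow> nat \<Rightarrow> int" (infixl "\<bowtie>" 70) where
  "p \<bowtie> c = fst p \<clubsuit> c + plum_carry (snd p) c"

end

theory Submission
  imports Defs
begin

text \<open>The bounds on \<open>d\<close> make it the ones digit of the product, so
  \<open>a \<clubsuit> b\<close> is \<open>d\<close> or \<open>d - 10\<close>. With both entries of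
  the pair equal, the wedge adds this value to the carry of the same product, which
  \<open>plum_carry_eq\<close> determines.\<close>

theorem theorem2:
  fixes a b :: nat and c d :: int
  assumes "a \<in> digits" and "b \<in> digits"
    and "0 \<le> c" and "c \<le> 9" and "0 \<le> d" and "d \<le> 9"
    and "int a * int b = 10 * c + d"
  shows "(d \<le> 3 \<longrightarrow> (a, a) \<bowtie> b = c + d) \<and> (d > 3 \<longrightarrow> (a, a) \<bowtie> b = c + d - 9)"
proof -
  have ab: "int (a * b) = 10 * c + d"
    using assms(7) by simp
  have "int ((a * b) mod 10) = (10 * c + d) mod 10"
    by (simp only: zmod_int ab of_nat_numeral)
  also have "\<dots> = d"
    using assms(5,6) by simp
  finally have mod: "int ((a * b) mod 10) = d" .
  then have plum: "a \<clubsuit> b = (if d \<le> 3 then d else d - 10)"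
    unfolding plum_def Let_def by auto
  have "10 * c + d = 10 * plum_carry a b + a \<clubsuit> b"
    using plum_carry_eq[of a b] by (simp only: ab)
  \<comment> \<open>Lowering the ones part by 10 raises the carry by 1; the net change in their sum
    is the -9 of the second case.\<close>
  with plum have "plum_carry a b = (if d \<le> 3 then c else c + 1)"
    by (simp split: if_splits)
  with plum show ?thesis
    by (simp add: plum_wedge_def)
qed

end
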